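(* Let $K$ be a group and let $H$ be a normal subgroup of $K$. If $H$ and $G=K/H$ are both residually finite, then $K$ is weakly sofic.
   Context: A group $K$ is weakly sofic (i.e. metrically approximable by finite groups with bi-invariant metrics) if there is $\alpha>0$ such that for every finite subset $\Phi\subseteq K$ and every $\varepsilon>0$ there exist a finite group $Q$ equipped with a bi-invariant metric $d$ (i.e. $d(xz,yz)=d(zx,zy)=d(x,y)$ for all $x,y,z\in Q$) of diameter at most $1$, and a map $\varphi:\Phi\to Q$ with $\varphi(1)=1$ (if $1\in\Phi$), such that $d(\varphi(gh),\varphi(g)\varphi(h))<\varepsilon$ whenever $g,h,gh\in\Phi$, and $d(\varphi(g),1)>\alpha$ for every $g\in\Phi\setminus\{1\}$. *)

theory Defs
  imports "HOL-Algebra.Algebra"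
begin

definition residually_finite :: "('a, 'b) monoid_scheme \<Rightarrow> bool" where
  "residually_finite G \<longleftrightarrow>
     (\<forall>g \<in> carrier G. g \<noteq> \<one>\<^bsub>G\<^esub> \<longrightarrow>
        (\<exists>N. N \<lhd> G \<and> finite (rcosets\<^bsub>G\<^esub> N) \<and> g \<notin> N))"

definition bi_invariant_metric :: "('a, 'b) monoid_scheme \<Rightarrow> ('a \<Rightarrow> 'a \<Rightarrow> real) \<Rightarrow> bool" where
  "bi_invariant_metric Q d \<longleftrightarrow>
     (\<forall>x \<in> carrier Q. \<forall>y \<in> carrier Q. (d x y = 0 \<longleftrightarrow> x = y) \<and> d x y = d y x) \<and>
     (\<forall>x \<in> carrier Q. \<forall>y \<in> carrier Q. \<forall>z \<in> carrier Q. d x z \<le> d x y + d y z) \<and>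
     (\<forall>x \<in> carrier Q. \<forall>y \<in> carrier Q. \<forall>z \<in> carrier Q.
        d (x \<otimes>\<^bsub>Q\<^esub> z) (y \<otimes>\<^bsub>Q\<^esub> z) = d x y \<and> d (z \<otimes>\<^bsub>Q\<^esub> x) (z \<otimes>\<^bsub>Q\<^esub> y) = d x y)"

text \<open>Weakly sofic group. The finite approximating groups Q range over groups
whose carrier is a (finite) set of natural numbers; every finite group is
isomorphic to such a group, so this captures all finite groups up to isomorphism.\<close>
definition weakly_sofic :: "('a, 'b) monoid_scheme \<Rightarrow> bool" where
  "weakly_sofic K \<longleftrightarrow>
     (\<exists>\<alpha>::real. \<alpha> > 0 \<and>
       (\<forall>\<Phi>. \<Phi> \<subseteq> carrier K \<and> finite \<Phi> \<longrightarrow>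
         (\<forall>\<epsilon>::real. \<epsilon> > 0 \<longrightarrow>
           (\<exists>(Q :: nat monoid) (d :: nat \<Rightarrow> nat \<Rightarrow> real) (\<phi> :: 'a \<Rightarrow> nat).
              group Q \<and> finite (carrier Q) \<and>
              bi_invariant_metric Q d \<and>
              (\<forall>x \<in> carrier Q. \<forall>y \<in> carrier Q. d x y \<le> 1) \<and>
              (\<forall>g \<in> \<Phi>. \<phi> g \<in> carrier Q) \<and>
              (\<one>\<^bsub>K\<^esub> \<in> \<Phi> \<longrightarrow> \<phi> \<one>\<^bsub>K\<^esub> = \<one>\<^bsub>Q\<^esub>) \<and>
              (\<forall>g \<in> \<Phi>. \<forall>h \<in> \<Phi>. g \<otimes>\<^bsub>K\<^esub> h \<in> \<Phi> \<longrightarrow>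
                  d (\<phi> (g \<otimes>\<^bsub>K\<^esub> h)) (\<phi> g \<otimes>\<^bsub>Q\<^esub> \<phi> h) < \<epsilon>) \<and>
              (\<forall>g \<in> \<Phi> - {\<one>\<^bsub>K\<^esub>}. d (\<phi> g) \<one>\<^bsub>Q\<^esub> > \<alpha>)))))"

end

theory Submission
  imports Defs
begin

text \<open>
  Let \<open>\<Phi> \<subseteq> K\<close> be finite and \<open>N > 0\<close>. Choose finite quotients \<open>\<theta> : H \<rightarrow> A\<close> and \<open>\<pi> : G \<rightarrow> P\<close>. With a
  section \<open>s : G \<rightarrow> K\<close> of the projection \<open>\<psi>\<close>, the Kaloujnine--Krasner cocycle \<open>s(x) g s(x \<psi>(g))\<inverse>\<close> embeds \<open>K\<close> into a wreath
  product of \<open>H\<close> by \<open>G\<close>. To descend to \<open>P\<close>, compose it with a map \<open>\<sigma> : P \<rightarrow> G\<close>. In general no \<open>\<sigma>\<close>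
  is equivariant everywhere, but if \<open>\<pi>\<close> is injective on a large finite set, then for every set \<open>I \<subseteq> P\<close> of at most \<open>N\<close>
  points there is a \<open>\<sigma>\<^sub>I\<close> which is equivariant under \<open>\<Phi>\<close> at the points of \<open>I\<close>. Taking all these \<open>I\<close> as
  coordinates gives a map \<open>\<phi>\<close> from \<open>K\<close> to a finite wreath product. At the position \<open>p\<close>, each defect
  \<open>\<phi>(gh) (\<phi>(g) \<phi>(h))\<inverse>\<close> is trivial in all coordinates \<open>I\<close> with \<open>p \<in> I\<close>; so a product of fewer than \<open>N\<close>
  conjugates of defects is, at the position \<open>1\<close>, trivial in some coordinate, whereas \<open>\<phi>(g)\<close> for
  \<open>g \<in> \<Phi> \<inter> H\<close>, \<open>g \<noteq> 1\<close>, has the value \<open>\<theta>(g) \<noteq> 1\<close> there in every coordinate. The corresponding length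
  function, divided by \<open>N\<close>, gives the metric.
\<close>

section \<open>Separating finite sets in finite quotients\<close>

text \<open>A coset of \<open>M \<inter> N\<close> is a coset of \<open>M\<close> intersected with a
  coset of \<open>N\<close>, and there are only finitely many such pairs.\<close>

lemma (in group) finite_rcosets_Int:
  assumes "subgroup M G" "subgroup N G" "finite (rcosets M)" "finite (rcosets N)"
  shows "finite (rcosets (M \<inter> N))"
proof -
  have "(M \<inter> N) #> x = (M #> x) \<inter> (N #> x)" if "x \<in> carrier G" for x
  proof -
    have "inj_on (\<lambda>y. y \<otimes> x) (carrier G)"
      using that by (auto simp: inj_on_def)
    then have "(\<lambda>y. y \<otimes> x) ` (M \<inter> N) = (\<lambda>y. y \<otimes> x) ` M \<inter> (\<lambda>y. y \<otimes> x) ` N"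
      using inj_on_image_Int assms(1,2) subgroup.subset by metis
    then show ?thesis
      unfolding r_coset_def by (simp add: UNION_singleton_eq_range)
  qed
  then have "rcosets (M \<inter> N) \<subseteq> (\<lambda>(A, B). A \<inter> B) ` ((rcosets M) \<times> (rcosets N))"
    unfolding RCOSETS_def by fastforce
  then show ?thesis
    using assms(3,4) by (meson finite_SigmaI finite_imageI finite_subset)
qed

text \<open>Separating subgroups for the nontrivial elements of \<open>D\<close> are intersected one
  after another, starting from the whole group.\<close>

lemma (in group) residually_finite_separates_finite_set:
  assumes "residually_finite G" "finite D" "D \<subseteq> carrier G"
  shows "\<exists>N. N \<lhd> G \<and> finite (rcosets N) \<and> (\<forall>x\<in>D. x \<in> N \<longrightarrow> x = \<one>)"
  using assms(2,3)
proof (induction D)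
  case empty
  have "rcosets (carrier G) = {carrier G}"
    unfolding RCOSETS_def using coset_join2[OF _ subgroup_self] by auto
  moreover have "carrier G \<lhd> G"
    by (simp add: normal_inv_iff subgroup_self)
  ultimately show ?case by (intro exI[of _ "carrier G"]) simp
next
  case (insert x D)
  then obtain N where N: "N \<lhd> G" "finite (rcosets N)" "\<forall>x\<in>D. x \<in> N \<longrightarrow> x = \<one>" by auto
  show ?case
  proof (cases "x = \<one>")
    case True
    with N show ?thesis by auto
  next
    case False
    then obtain M where M: "M \<lhd> G" "finite (rcosets M)" "x \<notin> M"
      using assms(1) insert.prems unfolding residually_finite_def by auto
    have "finite (rcosets (M \<inter> N))"
      using M N by (intro finite_rcosets_Int) (auto simp: normal_def)
    with normal_subgroup_intersect[OF M(1) N(1)] M(3) N(3) show ?thesis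
      by (intro exI[of _ "M \<inter> N"]) auto
  qed
qed

section \<open>Maps out of a finite quotient that are equivariant at few points\<close>

text \<open>Since \<open>D\<close> depends only on \<open>E\<close> and \<open>k\<close>, the
  quotient \<open>P\<close> can be chosen after it. The induction on \<open>k\<close> distinguishes
  whether the translates of \<open>E\<close> at the points of \<open>I\<close> are disjoint. If they
  are, each is labelled by \<open>E\<close> independently; if two meet, a point is removed from
  \<open>I\<close>. The unit in \<open>E\<close> makes every point belong to its own
  translate.\<close>

lemma (in group) equivariant_lift:
  assumes "finite E" "E \<subseteq> carrier G" "\<one> \<in> E"
  shows "\<exists>D. finite D \<and> D \<subseteq> carrier G \<and>
    (\<forall>(P :: ('c, 'd) monoid_scheme) \<pi> I.
       group P \<and> \<pi> \<in> hom G P \<and> (\<forall>x\<in>D. \<pi> x = \<one>\<^bsub>P\<^esub> \<longrightarrow> x = \<one>) \<and>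
       I \<subseteq> carrier P \<and> finite I \<and> card I \<le> k \<longrightarrow>
       (\<exists>\<sigma>. \<sigma> \<in> carrier P \<rightarrow> carrier G \<and> (\<forall>p\<in>I. \<forall>x\<in>E. \<sigma> (p \<otimes>\<^bsub>P\<^esub> \<pi> x) = \<sigma> p \<otimes> x)))"
  using assms
proof (induction k arbitrary: E)
  case 0
  show ?case by (intro exI[of _ "{}"]) (auto intro!: exI[of _ "\<lambda>_. \<one>"])
next
  case (Suc k)
  \<comment> \<open>If \<open>p\<close> times \<open>\<pi> a\<close> equals \<open>p'\<close> times
    \<open>\<pi> b\<close>, then \<open>p'\<close> times \<open>\<pi> x\<close> equals
    \<open>p\<close> times \<open>\<pi> (a \<otimes> inv b \<otimes> x)\<close>; the added elements
    express the translate of \<open>E\<close> at \<open>p'\<close> from \<open>p\<close>.\<close>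
  define E' where "E' = E \<union> (\<lambda>(a, b, x). a \<otimes> inv b \<otimes> x) ` (E \<times> E \<times> E)"
  have E': "finite E'" "E' \<subseteq> carrier G" "\<one> \<in> E'" "E \<subseteq> E'"
    using Suc.prems unfolding E'_def by auto
  from Suc.IH[OF E'(1-3)] obtain D where D: "finite D" "D \<subseteq> carrier G"
    and lift: "\<forall>(P :: ('c, 'd) monoid_scheme) \<pi> I.
       group P \<and> \<pi> \<in> hom G P \<and> (\<forall>x\<in>D. \<pi> x = \<one>\<^bsub>P\<^esub> \<longrightarrow> x = \<one>) \<and>
       I \<subseteq> carrier P \<and> finite I \<and> card I \<le> k \<longrightarrow>
       (\<exists>\<sigma>. \<sigma> \<in> carrier P \<rightarrow> carrier G \<and> (\<forall>p\<in>I. \<forall>x\<in>E'. \<sigma> (p \<otimes>\<^bsub>P\<^esub> \<pi> x) = \<sigma> p \<otimes> x))"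
    by (elim exE conjE)
  \<comment> \<open>The added quotients make \<open>\<pi>\<close> injective on \<open>E\<close>,
    which the case of disjoint translates uses.\<close>
  define D' where "D' = D \<union> (\<lambda>(a, b). inv a \<otimes> b) ` (E \<times> E)"
  have D': "finite D'" "D' \<subseteq> carrier G"
    using D Suc.prems unfolding D'_def by auto
  show ?case
  proof (intro exI[of _ D'] conjI allI impI D'; elim conjE)
    fix P :: "('c, 'd) monoid_scheme" and \<pi> I
    assume P: "group P" and \<pi>: "\<pi> \<in> hom G P" and sep: "\<forall>x\<in>D'. \<pi> x = \<one>\<^bsub>P\<^esub> \<longrightarrow> x = \<one>"
      and I: "I \<subseteq> carrier P" "finite I" "card I \<le> Suc k"
    interpret P: group P by fact
    interpret group_hom G P \<pi>
      using P \<pi> by (simp add: group_hom_def group_hom_axioms_def is_group)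
    have inE: "x \<in> carrier G" if "x \<in> E" for x using that Suc.prems by auto
    have inI: "p \<in> carrier P" if "p \<in> I" for p using that I by auto
    show "\<exists>\<sigma>. \<sigma> \<in> carrier P \<rightarrow> carrier G \<and> (\<forall>p\<in>I. \<forall>x\<in>E. \<sigma> (p \<otimes>\<^bsub>P\<^esub> \<pi> x) = \<sigma> p \<otimes> x)"
    proof (cases "\<forall>p\<in>I. \<forall>p'\<in>I. \<forall>a\<in>E. \<forall>b\<in>E. p \<otimes>\<^bsub>P\<^esub> \<pi> a = p' \<otimes>\<^bsub>P\<^esub> \<pi> b \<longrightarrow> p = p'")
      case False
      \<comment> \<open>Two translates of \<open>E\<close> meet: the point \<open>p'\<close> can be dropped if \<open>E\<close> is enlarged so as to reach it from \<open>p\<close>.\<close>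
      then obtain p p' a b where pp': "p \<in> I" "p' \<in> I" "p \<noteq> p'" and ab: "a \<in> E" "b \<in> E"
        and eq: "p \<otimes>\<^bsub>P\<^esub> \<pi> a = p' \<otimes>\<^bsub>P\<^esub> \<pi> b" by blast
      have "card (I - {p'}) \<le> k" using I pp' by auto
      moreover have "\<forall>x\<in>D. \<pi> x = \<one>\<^bsub>P\<^esub> \<longrightarrow> x = \<one>" using sep unfolding D'_def by blast
      ultimately have "\<exists>\<sigma>. \<sigma> \<in> carrier P \<rightarrow> carrier G \<and>
          (\<forall>q\<in>I - {p'}. \<forall>x\<in>E'. \<sigma> (q \<otimes>\<^bsub>P\<^esub> \<pi> x) = \<sigma> q \<otimes> x)"
        using I P \<pi> by (intro lift[rule_format] conjI) auto
      then obtain \<sigma> where \<sigma>: "\<sigma> \<in> carrier P \<rightarrow> carrier G"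
        and eqv: "\<And>q x. q \<in> I - {p'} \<Longrightarrow> x \<in> E' \<Longrightarrow> \<sigma> (q \<otimes>\<^bsub>P\<^esub> \<pi> x) = \<sigma> q \<otimes> x"
        by blast
      have p': "p' = p \<otimes>\<^bsub>P\<^esub> \<pi> (a \<otimes> inv b)"
        using eq pp' ab inE inI by (simp flip: P.m_assoc) (simp add: P.m_assoc)
      have shift: "\<sigma> (p' \<otimes>\<^bsub>P\<^esub> \<pi> x) = \<sigma> p \<otimes> (a \<otimes> inv b \<otimes> x)" if "x \<in> E" for x
      proof -
        have "p' \<otimes>\<^bsub>P\<^esub> \<pi> x = p \<otimes>\<^bsub>P\<^esub> \<pi> (a \<otimes> inv b \<otimes> x)"
          using p' pp' ab inE inI that by (simp add: P.m_assoc)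
        moreover have "a \<otimes> inv b \<otimes> x \<in> E'" using ab that unfolding E'_def by force
        ultimately show ?thesis using eqv pp' by simp
      qed
      \<comment> \<open>Besides the instance at \<open>x\<close>, \<open>shift\<close> is used at
        the unit, where it gives
        \<open>\<sigma> p' = \<sigma> p \<otimes> (a \<otimes> inv b)\<close>.\<close>
      have "\<sigma> (p' \<otimes>\<^bsub>P\<^esub> \<pi> x) = \<sigma> p' \<otimes> x" if "x \<in> E" for x
        using shift[OF that] shift[OF Suc.prems(3)] that ab pp' inE inI \<sigma>
        by (simp add: Pi_iff m_assoc)
      then have "\<forall>q\<in>I. \<forall>x\<in>E. \<sigma> (q \<otimes>\<^bsub>P\<^esub> \<pi> x) = \<sigma> q \<otimes> x"
        using eqv E'(4) by blast
      with \<sigma> show ?thesis by blast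
    next
      case True
      have inj: "x = y" if "x \<in> E" "y \<in> E" "\<pi> x = \<pi> y" for x y
      proof -
        have "\<pi> (inv x \<otimes> y) = \<one>\<^bsub>P\<^esub>" using that inE by simp
        moreover have "inv x \<otimes> y \<in> D'" using that unfolding D'_def by force
        ultimately have "inv x \<otimes> y = \<one>" using sep by blast
        then have "y = x \<otimes> \<one>" using that inE inv_solve_left[of \<one> x y] by simp
        then show ?thesis using that inE by simp
      qed
      \<comment> \<open>By disjointness and injectivity, a point of a translate determines its label
        in \<open>E\<close>. Equivariance demands nothing outside the translates, so the unit serves
        as default there.\<close>
      define \<sigma> where "\<sigma> q = (if \<exists>x\<in>E. \<exists>p\<in>I. q = p \<otimes>\<^bsub>P\<^esub> \<pi> x
        then SOME x. x \<in> E \<and> (\<exists>p\<in>I. q = p \<otimes>\<^bsub>P\<^esub> \<pi> x) else \<one>)" for q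
      have \<sigma>_eq: "\<sigma> (p \<otimes>\<^bsub>P\<^esub> \<pi> x) = x" if px: "p \<in> I" "x \<in> E" for p x
      proof -
        have "y = x" if y: "y \<in> E \<and> (\<exists>p'\<in>I. p \<otimes>\<^bsub>P\<^esub> \<pi> x = p' \<otimes>\<^bsub>P\<^esub> \<pi> y)" for y
        proof -
          from y obtain p' where p': "y \<in> E" "p' \<in> I" "p \<otimes>\<^bsub>P\<^esub> \<pi> x = p' \<otimes>\<^bsub>P\<^esub> \<pi> y" by blast
          from True[rule_format, OF px(1) p'(2) px(2) p'(1,3)] have "p = p'" .
          with p' px have "\<pi> x = \<pi> y" using inE inI by simp
          with inj p' px show ?thesis by simp
        qed
        then have "(SOME y. y \<in> E \<and> (\<exists>p'\<in>I. p \<otimes>\<^bsub>P\<^esub> \<pi> x = p' \<otimes>\<^bsub>P\<^esub> \<pi> y)) = x"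
          using px by (intro some_equality) auto
        then show ?thesis using px unfolding \<sigma>_def by auto
      qed
      have "\<sigma> q \<in> carrier G" for q
      proof (cases "\<exists>x\<in>E. \<exists>p\<in>I. q = p \<otimes>\<^bsub>P\<^esub> \<pi> x")
        case True
        then show ?thesis using \<sigma>_eq inE by auto
      qed (simp add: \<sigma>_def)
      moreover have "\<sigma> (p \<otimes>\<^bsub>P\<^esub> \<pi> x) = \<sigma> p \<otimes> x" if "p \<in> I" "x \<in> E" for p x
        using \<sigma>_eq[OF that] \<sigma>_eq[OF that(1) Suc.prems(3)] that inE inI by simp
      ultimately show ?thesis by (intro exI[of _ \<sigma>]) auto
    qed
  qed
qed

text \<open>Left multiplication by a constant preserves equivariance under right multiplication. The
  normalization at the unit is what later makes the cocycle value at position 1 equal to the group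
  element itself.\<close>

lemma (in group) normalized_equivariant_lift:
  assumes "group P" "\<sigma> \<in> carrier P \<rightarrow> carrier G" "\<pi> \<in> E \<rightarrow> carrier P" "I \<subseteq> carrier P" "E \<subseteq> carrier G"
    and "\<forall>p\<in>I. \<forall>x\<in>E. \<sigma> (p \<otimes>\<^bsub>P\<^esub> \<pi> x) = \<sigma> p \<otimes> x"
  shows "\<exists>\<sigma>. \<sigma> \<in> carrier P \<rightarrow> carrier G \<and> \<sigma> \<one>\<^bsub>P\<^esub> = \<one> \<and>
    (\<forall>p\<in>I. \<forall>x\<in>E. \<sigma> (p \<otimes>\<^bsub>P\<^esub> \<pi> x) = \<sigma> p \<otimes> x)"
proof -
  interpret P: group P by fact
  have \<sigma>: "\<sigma> p \<in> carrier G" if "p \<in> carrier P" for p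
    using assms(2) that by auto
  show ?thesis
  proof (intro exI[of _ "\<lambda>p. inv (\<sigma> \<one>\<^bsub>P\<^esub>) \<otimes> \<sigma> p"] conjI ballI)
    fix p x assume "p \<in> I" "x \<in> E"
    moreover from this have "p \<in> carrier P" "x \<in> carrier G" "\<pi> x \<in> carrier P"
      using assms by auto
    ultimately show "inv (\<sigma> \<one>\<^bsub>P\<^esub>) \<otimes> \<sigma> (p \<otimes>\<^bsub>P\<^esub> \<pi> x) = inv (\<sigma> \<one>\<^bsub>P\<^esub>) \<otimes> \<sigma> p \<otimes> x"
      using assms(6) \<sigma> by (simp add: m_assoc)
  qed (use \<sigma> in auto)
qed

section \<open>Bi-invariant metrics from filtrations\<close>

text \<open>The index of the first \<open>L n\<close> containing an element is a length function:
  \<open>L_0\<close> gives definiteness, \<open>L_inv\<close> symmetry, \<open>L_mult\<close> the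
  triangle inequality, and \<open>L_conj\<close> left invariance. Right invariance holds because
  \<open>x \<otimes> inv y\<close> does not change.\<close>

lemma bi_invariant_metric_of_filtration:
  fixes Q (structure) and N :: nat
  assumes "group Q" and "N > 0"
    and L_0: "L 0 = {\<one>}"
    and L_inv: "\<And>n x. x \<in> carrier Q \<Longrightarrow> x \<in> L n \<Longrightarrow> inv x \<in> L n"
    and L_conj: "\<And>n x y. x \<in> carrier Q \<Longrightarrow> y \<in> carrier Q \<Longrightarrow> x \<in> L n \<Longrightarrow> y \<otimes> x \<otimes> inv y \<in> L n"
    and L_mult: "\<And>m n x y. x \<in> carrier Q \<Longrightarrow> y \<in> carrier Q \<Longrightarrow> x \<in> L m \<Longrightarrow> y \<in> L n \<Longrightarrow> x \<otimes> y \<in> L (m + n)"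
  defines "d \<equiv> \<lambda>x y. real (LEAST n. N \<le> n \<or> x \<otimes> inv y \<in> L n) / real N"
  shows "bi_invariant_metric Q d"
    and "d x y \<le> 1"
    and "x \<otimes> inv y \<in> L n \<Longrightarrow> d x y \<le> real n / real N"
    and "(\<And>n. n < N \<Longrightarrow> x \<otimes> inv y \<notin> L n) \<Longrightarrow> d x y = 1"
proof -
  interpret group Q by fact
  \<comment> \<open>The alternative \<open>N \<le> n\<close> makes the minimum exist for elements
    outside every \<open>L n\<close> and caps the length at \<open>N\<close>.\<close>
  define len where "len x = (LEAST n. N \<le> n \<or> x \<in> L n)" for x
  have d: "d x y = real (len (x \<otimes> inv y)) / real N" for x y
    unfolding d_def len_def ..
  have len_le: "len x \<le> n" if "N \<le> n \<or> x \<in> L n" for x n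
    unfolding len_def using that by (rule Least_le)
  have len: "N \<le> len x \<or> x \<in> L (len x)" for x
    unfolding len_def by (rule LeastI[of _ N]) simp
  have len_0: "len x = 0 \<longleftrightarrow> x = \<one>" for x
  proof
    assume "len x = 0"
    with len[of x] show "x = \<one>" using L_0 \<open>N > 0\<close> by simp
  qed (use len_le[of 0 x] L_0 in simp)
  have le: "len x \<le> len y" if "\<And>n. y \<in> L n \<Longrightarrow> x \<in> L n" for x y
    using len[of y] that by (intro len_le) auto
  have len_inv: "len (inv x) = len x" if "x \<in> carrier Q" for x
    using L_inv[of x] L_inv[of "inv x"] that by (intro antisym le) auto
  have len_conj: "len (y \<otimes> x \<otimes> inv y) = len x" if "x \<in> carrier Q" "y \<in> carrier Q" for x y
  proof (intro antisym le)
    fix n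
    show "x \<in> L n \<Longrightarrow> y \<otimes> x \<otimes> inv y \<in> L n" using that by (rule L_conj)
    assume "y \<otimes> x \<otimes> inv y \<in> L n"
    then have "inv y \<otimes> (y \<otimes> x \<otimes> inv y) \<otimes> inv (inv y) \<in> L n"
      using that by (intro L_conj[of "y \<otimes> x \<otimes> inv y"]) simp_all
    moreover have "inv y \<otimes> (y \<otimes> x \<otimes> inv y) \<otimes> inv (inv y) = x"
      using that by (simp add: m_assoc) (simp flip: m_assoc)
    ultimately show "x \<in> L n" by simp
  qed
  have len_mult: "len (x \<otimes> y) \<le> len x + len y" if "x \<in> carrier Q" "y \<in> carrier Q" for x y
    using len[of x] len[of y] L_mult[OF that] by (intro len_le) auto
  have cancel: "x \<otimes> inv y = (x \<otimes> z) \<otimes> inv (y \<otimes> z)"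
    if "x \<in> carrier Q" "y \<in> carrier Q" "z \<in> carrier Q" for x y z
    using that by (simp add: inv_mult_group m_assoc) (simp flip: m_assoc)
  show "bi_invariant_metric Q d"
    unfolding bi_invariant_metric_def
  proof (intro conjI ballI)
    fix x y assume xy: "x \<in> carrier Q" "y \<in> carrier Q"
    show "d x y = 0 \<longleftrightarrow> x = y"
      using xy \<open>N > 0\<close> by (auto simp: d len_0 inv_solve_right')
    show "d x y = d y x"
      using len_inv[of "x \<otimes> inv y"] xy by (simp add: d inv_mult_group)
    fix z assume z: "z \<in> carrier Q"
    have "x \<otimes> inv z = (x \<otimes> inv y) \<otimes> (y \<otimes> inv z)"
      using xy z by (simp add: m_assoc) (simp flip: m_assoc)
    then show "d x z \<le> d x y + d y z"
      using len_mult[of "x \<otimes> inv y" "y \<otimes> inv z"] xy z \<open>N > 0\<close>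
      by (simp add: d divide_right_mono flip: add_divide_distrib)
    show "d (x \<otimes> z) (y \<otimes> z) = d x y"
      using cancel[OF xy z] by (simp add: d)
    have "(z \<otimes> x) \<otimes> inv (z \<otimes> y) = z \<otimes> (x \<otimes> inv y) \<otimes> inv z"
      using xy z by (simp add: inv_mult_group m_assoc)
    then show "d (z \<otimes> x) (z \<otimes> y) = d x y"
      using len_conj[of "x \<otimes> inv y" z] xy z by (simp add: d)
  qed
  have "len z \<le> N" for z using len_le by blast
  then show "d x y \<le> 1"
    using \<open>N > 0\<close> by (simp add: d)
  show "d x y \<le> real n / real N" if "x \<otimes> inv y \<in> L n"
    using len_le that by (simp add: d divide_right_mono)
  show "d x y = 1" if "\<And>n. n < N \<Longrightarrow> x \<otimes> inv y \<notin> L n"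
  proof -
    have "N \<le> len (x \<otimes> inv y)"
      using len[of "x \<otimes> inv y"] that not_le by blast
    then have "len (x \<otimes> inv y) = N" using len_le by (simp add: le_antisym)
    then show ?thesis using \<open>N > 0\<close> by (simp add: d)
  qed
qed

section \<open>Quotient projections; the wreath product and the filtration of its base\<close>

lemma (in group) FactGroup_projection:
  assumes "N \<lhd> G"
  shows "(#>) N \<in> hom G (G Mod N)" "(#>) N ` carrier G = carrier (G Mod N)"
    and "x \<in> carrier G \<Longrightarrow> N #> x = \<one>\<^bsub>G Mod N\<^esub> \<longleftrightarrow> x \<in> N"
proof -
  interpret normal N G by fact
  show "(#>) N \<in> hom G (G Mod N)"
    using r_coset_hom_Mod by (simp add: hom_def)
  show "(#>) N ` carrier G = carrier (G Mod N)" by (simp add: carrier_FactGroup)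
  show "N #> x = \<one>\<^bsub>G Mod N\<^esub> \<longleftrightarrow> x \<in> N" if "x \<in> carrier G"
    using that coset_join1[of N x] coset_join2[of x N] subgroup_axioms rcos_self[of x N] by auto
qed

locale wreath = A: group A + P: group P
  for A :: "('a, 'b) monoid_scheme" and P :: "('p, 'c) monoid_scheme" +
  fixes S :: "'i set"
begin

text \<open>This is the wreath product of the power of \<open>A\<close> over \<open>S\<close> by
  \<open>P\<close>. The group \<open>P\<close> moves positions by right multiplication and fixes the
  coordinates in \<open>S\<close>; with this convention a map
  \<open>g \<mapsto> (c g, \<pi> g)\<close> is multiplicative exactly when \<open>c\<close> is a
  cocycle. Extensional functions keep the carrier finite.\<close>

definition Q :: "(('i \<times> 'p \<Rightarrow> 'a) \<times> 'p) monoid" where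
  "Q = \<lparr>carrier = ((S \<times> carrier P) \<rightarrow>\<^sub>E carrier A) \<times> carrier P,
     monoid.mult = (\<lambda>x y. (\<lambda>z\<in>S \<times> carrier P. fst x z \<otimes>\<^bsub>A\<^esub> fst y (fst z, snd z \<otimes>\<^bsub>P\<^esub> snd x),
       snd x \<otimes>\<^bsub>P\<^esub> snd y)),
     one = (\<lambda>z\<in>S \<times> carrier P. \<one>\<^bsub>A\<^esub>, \<one>\<^bsub>P\<^esub>)\<rparr>"

lemma carrier_Q: "carrier Q = ((S \<times> carrier P) \<rightarrow>\<^sub>E carrier A) \<times> carrier P"
  by (simp add: Q_def)

lemma snd_closed [simp]: "x \<in> carrier Q \<Longrightarrow> snd x \<in> carrier P"
  by (auto simp: carrier_Q)

lemma fst_closed [simp]: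
  "x \<in> carrier Q \<Longrightarrow> i \<in> S \<Longrightarrow> p \<in> carrier P \<Longrightarrow> fst x (i, p) \<in> carrier A"
  by (auto simp: carrier_Q)

lemma fst_mult [simp]: "i \<in> S \<Longrightarrow> p \<in> carrier P \<Longrightarrow>
    fst (x \<otimes>\<^bsub>Q\<^esub> y) (i, p) = fst x (i, p) \<otimes>\<^bsub>A\<^esub> fst y (i, p \<otimes>\<^bsub>P\<^esub> snd x)"
  by (simp add: Q_def)

lemma snd_mult [simp]: "snd (x \<otimes>\<^bsub>Q\<^esub> y) = snd x \<otimes>\<^bsub>P\<^esub> snd y"
  by (simp add: Q_def)

lemma fst_one [simp]: "i \<in> S \<Longrightarrow> p \<in> carrier P \<Longrightarrow> fst \<one>\<^bsub>Q\<^esub> (i, p) = \<one>\<^bsub>A\<^esub>"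
  by (simp add: Q_def)

lemma snd_one [simp]: "snd \<one>\<^bsub>Q\<^esub> = \<one>\<^bsub>P\<^esub>"
  by (simp add: Q_def)

lemma one_closed [simp]: "\<one>\<^bsub>Q\<^esub> \<in> carrier Q"
  by (auto simp: Q_def)

lemma restrict_in_Q [simp]:
  assumes "\<And>i p. i \<in> S \<Longrightarrow> p \<in> carrier P \<Longrightarrow> f (i, p) \<in> carrier A" "q \<in> carrier P"
  shows "(restrict f (S \<times> carrier P), q) \<in> carrier Q"
  using assms by (auto simp: carrier_Q)

lemma mult_closed [simp]:
  assumes "x \<in> carrier Q" "y \<in> carrier Q" shows "x \<otimes>\<^bsub>Q\<^esub> y \<in> carrier Q"
proof -
  have "x \<otimes>\<^bsub>Q\<^esub> y = (\<lambda>z\<in>S \<times> carrier P. fst x z \<otimes>\<^bsub>A\<^esub> fst y (fst z, snd z \<otimes>\<^bsub>P\<^esub> snd x),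
      snd x \<otimes>\<^bsub>P\<^esub> snd y)"
    by (simp add: Q_def)
  with assms show ?thesis by simp
qed

lemma Q_eqI:
  assumes "x \<in> carrier Q" "y \<in> carrier Q"
    and "\<And>i p. i \<in> S \<Longrightarrow> p \<in> carrier P \<Longrightarrow> fst x (i, p) = fst y (i, p)"
    and "snd x = snd y"
  shows "x = y"
proof (rule prod_eqI)
  have "fst x \<in> (S \<times> carrier P) \<rightarrow>\<^sub>E carrier A" "fst y \<in> (S \<times> carrier P) \<rightarrow>\<^sub>E carrier A"
    using assms(1,2) by (auto simp: carrier_Q)
  then show "fst x = fst y" by (rule PiE_ext) (use assms(3) in auto)
qed fact

lemma group_Q: "group Q"
proof (rule groupI)
  fix x assume x: "x \<in> carrier Q"
  let ?y = "(\<lambda>z\<in>S \<times> carrier P. inv\<^bsub>A\<^esub> (fst x (fst z, snd z \<otimes>\<^bsub>P\<^esub> inv\<^bsub>P\<^esub> (snd x))), inv\<^bsub>P\<^esub> (snd x))"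
  have y: "?y \<in> carrier Q" using x by simp
  moreover have "?y \<otimes>\<^bsub>Q\<^esub> x = \<one>\<^bsub>Q\<^esub>"
    using x y by (intro Q_eqI mult_closed) simp_all
  ultimately show "\<exists>y\<in>carrier Q. y \<otimes>\<^bsub>Q\<^esub> x = \<one>\<^bsub>Q\<^esub>" by blast
qed (simp_all, (rule Q_eqI; simp add: A.m_assoc P.m_assoc)+)

sublocale Q: group Q by (rule group_Q)

lemma snd_inv [simp]:
  assumes "x \<in> carrier Q" shows "snd (inv\<^bsub>Q\<^esub> x) = inv\<^bsub>P\<^esub> (snd x)"
proof -
  have "snd (inv\<^bsub>Q\<^esub> x \<otimes>\<^bsub>Q\<^esub> x) = \<one>\<^bsub>P\<^esub>" using assms by simp
  then show ?thesis using assms by (metis P.inv_equality Q.inv_closed snd_closed snd_mult)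
qed

lemma fst_inv [simp]:
  assumes "x \<in> carrier Q" "i \<in> S" "p \<in> carrier P"
  shows "fst (inv\<^bsub>Q\<^esub> x) (i, p) = inv\<^bsub>A\<^esub> (fst x (i, p \<otimes>\<^bsub>P\<^esub> inv\<^bsub>P\<^esub> (snd x)))"
proof -
  have "fst (inv\<^bsub>Q\<^esub> x) (i, p) \<otimes>\<^bsub>A\<^esub> fst x (i, p \<otimes>\<^bsub>P\<^esub> inv\<^bsub>P\<^esub> (snd x))
      = fst (inv\<^bsub>Q\<^esub> x \<otimes>\<^bsub>Q\<^esub> x) (i, p)"
    using fst_mult[OF assms(2,3), of "inv\<^bsub>Q\<^esub> x" x] assms(1) by (simp only: snd_inv)
  also have "\<dots> = \<one>\<^bsub>A\<^esub>" using assms by (simp del: fst_mult)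
  finally have "fst (inv\<^bsub>Q\<^esub> x) (i, p) \<otimes>\<^bsub>A\<^esub> fst x (i, p \<otimes>\<^bsub>P\<^esub> inv\<^bsub>P\<^esub> (snd x)) = \<one>\<^bsub>A\<^esub>" .
  from A.inv_equality[OF this] show ?thesis using assms by simp
qed

lemma finite_Q:
  assumes "finite S" "finite (carrier A)" "finite (carrier P)"
  shows "finite (carrier Q)"
  using assms by (simp add: carrier_Q finite_PiE)

end

text \<open>The wreath coordinates are indexed by sets \<open>I\<close> of base points. A base part lies in \<open>small n\<close> if each
  of its values is trivial in all coordinates \<open>I\<close> that contain \<open>n\<close> suitable points (which may
  depend on the position \<open>p\<close>, so that the condition survives conjugation).\<close>

locale support_wreath = wreath A P S
  for A :: "('a, 'b) monoid_scheme" and P :: "('p, 'c) monoid_scheme" and S :: "'p set set"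
begin

definition small :: "nat \<Rightarrow> (('p set \<times> 'p \<Rightarrow> 'a) \<times> 'p) set" where
  "small n = {x \<in> carrier Q. snd x = \<one>\<^bsub>P\<^esub> \<and> (\<forall>p\<in>carrier P. \<exists>J\<subseteq>carrier P. finite J \<and> card J \<le> n \<and>
     (\<forall>I\<in>S. J \<subseteq> I \<longrightarrow> fst x (I, p) = \<one>\<^bsub>A\<^esub>))}"

lemma small_support:
  assumes "x \<in> small n" "p \<in> carrier P"
  obtains J where "J \<subseteq> carrier P" "finite J" "card J \<le> n"
    "\<forall>I\<in>S. J \<subseteq> I \<longrightarrow> fst x (I, p) = \<one>\<^bsub>A\<^esub>"
proof -
  have "\<exists>J\<subseteq>carrier P. finite J \<and> card J \<le> n \<and> (\<forall>I\<in>S. J \<subseteq> I \<longrightarrow> fst x (I, p) = \<one>\<^bsub>A\<^esub>)"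
    using assms by (simp add: small_def)
  then show thesis using that by (elim exE conjE)
qed

text \<open>For \<open>n = 0\<close> the only candidate for \<open>J\<close> is the empty set, so
  every coordinate must be trivial.\<close>

lemma small_0: "small 0 = {\<one>\<^bsub>Q\<^esub>}"
proof -
  have "x = \<one>\<^bsub>Q\<^esub>" if "x \<in> small 0" for x
    using that by (intro Q_eqI) (auto simp: small_def)
  then show ?thesis by (auto simp: small_def)
qed

lemma small_inv:
  assumes "x \<in> small n" shows "inv\<^bsub>Q\<^esub> x \<in> small n"
proof -
  have x: "x \<in> carrier Q" "snd x = \<one>\<^bsub>P\<^esub>" using assms by (auto simp: small_def)
  have "\<exists>J\<subseteq>carrier P. finite J \<and> card J \<le> n \<and>
     (\<forall>I\<in>S. J \<subseteq> I \<longrightarrow> fst (inv\<^bsub>Q\<^esub> x) (I, p) = \<one>\<^bsub>A\<^esub>)" if p: "p \<in> carrier P" for p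
  proof -
    obtain J where "J \<subseteq> carrier P" "finite J" "card J \<le> n"
      and J: "\<forall>I\<in>S. J \<subseteq> I \<longrightarrow> fst x (I, p) = \<one>\<^bsub>A\<^esub>"
      using assms p by (rule small_support)
    moreover have "fst (inv\<^bsub>Q\<^esub> x) (I, p) = \<one>\<^bsub>A\<^esub>" if "I \<in> S" "J \<subseteq> I" for I
      using J[rule_format, OF that] that p x by simp
    ultimately show ?thesis by blast
  qed
  then show ?thesis using x by (simp add: small_def)
qed

text \<open>At position \<open>p\<close> the conjugate takes a conjugate of the value of
  \<open>x\<close> at \<open>p\<close> times \<open>snd y\<close>, in the same coordinate
  \<open>I\<close>; hence the set \<open>J\<close> of the shifted position works.\<close>

lemma small_conj:
  assumes "x \<in> small n" and y: "y \<in> carrier Q"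
  shows "y \<otimes>\<^bsub>Q\<^esub> x \<otimes>\<^bsub>Q\<^esub> inv\<^bsub>Q\<^esub> y \<in> small n"
proof -
  have x: "x \<in> carrier Q" "snd x = \<one>\<^bsub>P\<^esub>" using assms by (auto simp: small_def)
  have "\<exists>J\<subseteq>carrier P. finite J \<and> card J \<le> n \<and>
     (\<forall>I\<in>S. J \<subseteq> I \<longrightarrow> fst (y \<otimes>\<^bsub>Q\<^esub> x \<otimes>\<^bsub>Q\<^esub> inv\<^bsub>Q\<^esub> y) (I, p) = \<one>\<^bsub>A\<^esub>)" if p: "p \<in> carrier P" for p
  proof -
    have "p \<otimes>\<^bsub>P\<^esub> snd y \<in> carrier P" using p y by simp
    with assms(1) obtain J where "J \<subseteq> carrier P" "finite J" "card J \<le> n"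
      and J: "\<forall>I\<in>S. J \<subseteq> I \<longrightarrow> fst x (I, p \<otimes>\<^bsub>P\<^esub> snd y) = \<one>\<^bsub>A\<^esub>"
      by (rule small_support)
    moreover have "fst (y \<otimes>\<^bsub>Q\<^esub> x \<otimes>\<^bsub>Q\<^esub> inv\<^bsub>Q\<^esub> y) (I, p) = \<one>\<^bsub>A\<^esub>" if "I \<in> S" "J \<subseteq> I" for I
      using J[rule_format, OF that] that p y x by (simp add: P.m_assoc)
    ultimately show ?thesis by blast
  qed
  then show ?thesis using x y by (simp add: small_def)
qed

text \<open>A coordinate containing \<open>J \<union> J'\<close> is trivial for both factors, and
  cardinalities add at most.\<close>

lemma small_mult:
  assumes "x \<in> small m" "y \<in> small n" shows "x \<otimes>\<^bsub>Q\<^esub> y \<in> small (m + n)"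
proof -
  have xy: "x \<in> carrier Q" "snd x = \<one>\<^bsub>P\<^esub>" "y \<in> carrier Q" "snd y = \<one>\<^bsub>P\<^esub>"
    using assms by (auto simp: small_def)
  have "\<exists>J\<subseteq>carrier P. finite J \<and> card J \<le> m + n \<and>
     (\<forall>I\<in>S. J \<subseteq> I \<longrightarrow> fst (x \<otimes>\<^bsub>Q\<^esub> y) (I, p) = \<one>\<^bsub>A\<^esub>)" if p: "p \<in> carrier P" for p
  proof -
    obtain J where J: "J \<subseteq> carrier P" "finite J" "card J \<le> m"
      "\<forall>I\<in>S. J \<subseteq> I \<longrightarrow> fst x (I, p) = \<one>\<^bsub>A\<^esub>"
      using assms(1) p by (rule small_support)
    obtain J' where J': "J' \<subseteq> carrier P" "finite J'" "card J' \<le> n"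
      "\<forall>I\<in>S. J' \<subseteq> I \<longrightarrow> fst y (I, p) = \<one>\<^bsub>A\<^esub>"
      using assms(2) p by (rule small_support)
    have "card (J \<union> J') \<le> m + n" using card_Un_le[of J J'] J(3) J'(3) by linarith
    moreover have "fst (x \<otimes>\<^bsub>Q\<^esub> y) (I, p) = \<one>\<^bsub>A\<^esub>" if "I \<in> S" "J \<union> J' \<subseteq> I" for I
      using J(4)[rule_format, of I] J'(4)[rule_format, of I] that p xy by simp
    ultimately show ?thesis using J(1,2) J'(1,2) by (intro exI[of _ "J \<union> J'"]) simp
  qed
  then show ?thesis using xy by (simp add: small_def)
qed

text \<open>Agreement at \<open>p\<close> is required only in coordinates \<open>I\<close> with
  \<open>p \<in> I\<close>, so \<open>J = {p}\<close> works. The multiplicativity defects below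
  satisfy exactly this.\<close>

lemma mult_inv_in_small_1:
  assumes x: "x \<in> carrier Q" and y: "y \<in> carrier Q" and "snd x = snd y"
    and eq: "\<And>I p. I \<in> S \<Longrightarrow> p \<in> I \<Longrightarrow> p \<in> carrier P \<Longrightarrow> fst x (I, p) = fst y (I, p)"
  shows "x \<otimes>\<^bsub>Q\<^esub> inv\<^bsub>Q\<^esub> y \<in> small 1"
proof -
  have "fst (x \<otimes>\<^bsub>Q\<^esub> inv\<^bsub>Q\<^esub> y) (I, p) = \<one>\<^bsub>A\<^esub>" if "I \<in> S" "p \<in> carrier P" "{p} \<subseteq> I" for I p
    using eq[of I p] that assms(1-3) by (simp add: P.m_assoc)
  then have "\<exists>J\<subseteq>carrier P. finite J \<and> card J \<le> 1 \<and>
     (\<forall>I\<in>S. J \<subseteq> I \<longrightarrow> fst (x \<otimes>\<^bsub>Q\<^esub> inv\<^bsub>Q\<^esub> y) (I, p) = \<one>\<^bsub>A\<^esub>)" if "p \<in> carrier P" for p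
    using that by (intro exI[of _ "{p}"]) simp
  then show ?thesis using assms(1-3) by (simp add: small_def)
qed

text \<open>A set \<open>J\<close> witnessing smallness at position 1 is itself a coordinate, and
  the choice \<open>I = J\<close> contradicts nontriviality there.\<close>

lemma notin_small:
  assumes "snd x = \<one>\<^bsub>P\<^esub> \<Longrightarrow> \<forall>J\<in>S. fst x (J, \<one>\<^bsub>P\<^esub>) \<noteq> \<one>\<^bsub>A\<^esub>"
    and "\<And>J. J \<subseteq> carrier P \<Longrightarrow> finite J \<Longrightarrow> card J \<le> n \<Longrightarrow> J \<in> S"
  shows "x \<notin> small n"
proof
  assume "x \<in> small n"
  then obtain J where J: "J \<subseteq> carrier P" "finite J" "card J \<le> n"
    "\<forall>I\<in>S. J \<subseteq> I \<longrightarrow> fst x (I, \<one>\<^bsub>P\<^esub>) = \<one>\<^bsub>A\<^esub>"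
    using P.one_closed by (rule small_support)
  moreover have "snd x = \<one>\<^bsub>P\<^esub>" using \<open>x \<in> small n\<close> by (simp add: small_def)
  ultimately show False using assms by blast
qed

end

section \<open>Transport to groups on natural numbers\<close>

lemma nat_copy_of_finite_group:
  fixes Q :: "('q, 'r) monoid_scheme"
  assumes "group Q" "finite (carrier Q)"
  obtains Q' :: "nat monoid" and f where "group Q'" "f \<in> iso Q Q'" "finite (carrier Q')"
proof -
  interpret group Q by fact
  obtain f :: "'q \<Rightarrow> nat" where f: "inj_on f (carrier Q)"
    using assms(2) finite_imp_inj_to_nat_seg by metis
  \<comment> \<open>By injectivity, \<open>f x = f y\<close> holds exactly when
    \<open>x \<otimes> inv y\<close> lies in the trivial subgroup; this lets the multiplication pass
    to the image of \<open>f\<close>.\<close>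
  have "weak_group_morphism f {\<one>\<^bsub>Q\<^esub>} Q"
    using f by (intro weak_group_morphismsI one_is_normal) (auto simp: inj_on_def inv_solve_right')
  then have "group (image_group f Q)" by (rule image_group_is_group)
  moreover have "f \<in> iso Q (image_group f Q)"
    using f by (auto simp: iso_def hom_def image_group_def bij_betw_def)
  moreover have "finite (carrier (image_group f Q))"
    using assms(2) by (simp add: image_group_carrier)
  ultimately show thesis by (rule that)
qed

lemma bi_invariant_metric_iso:
  assumes "group Q" "group Q'" "f \<in> iso Q Q'" "bi_invariant_metric Q d"
  defines "g \<equiv> inv_into (carrier Q) f"
  shows "bi_invariant_metric Q' (\<lambda>x y. d (g x) (g y))"
proof -
  have g: "g \<in> iso Q' Q" unfolding g_def using assms(1,3) by (simp add: group.iso_set_sym)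
  then have "bij_betw g (carrier Q') (carrier Q)" by (simp add: iso_def)
  then have eq: "g x = g y \<longleftrightarrow> x = y" and mem: "g x \<in> carrier Q"
    if "x \<in> carrier Q'" "y \<in> carrier Q'" for x y
    using that by (auto simp: bij_betw_def inj_on_def)
  have mult: "g (x \<otimes>\<^bsub>Q'\<^esub> y) = g x \<otimes>\<^bsub>Q\<^esub> g y" if "x \<in> carrier Q'" "y \<in> carrier Q'" for x y
    using g that by (simp add: iso_def hom_def)
  show ?thesis
    using assms(4) eq mem mult unfolding bi_invariant_metric_def by simp
qed

section \<open>The cocycle and the finite approximation\<close>

lemma (in group) mult_inv_telescope:
  assumes "a \<in> carrier G" "b \<in> carrier G" "c \<in> carrier G" "g \<in> carrier G" "h \<in> carrier G"
  shows "(a \<otimes> g \<otimes> inv b) \<otimes> (b \<otimes> h \<otimes> inv c) = a \<otimes> (g \<otimes> h) \<otimes> inv c"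
  using assms by (simp add: m_assoc) (simp flip: m_assoc)

text \<open>The finite quotients enter only through the homomorphisms \<open>\<theta>\<close> and
  \<open>\<pi>\<close> and the separation and lifting conditions on them. Nontrivial elements of
  \<open>\<Phi>\<close> outside \<open>H\<close> are detected by the component in \<open>P\<close>,
  those in \<open>H\<close> by the base value at position 1.\<close>

lemma finite_approximation:
  fixes K :: "('k, 'e) monoid_scheme" and G :: "('g, 'f) monoid_scheme"
    and A :: "('a, 'b) monoid_scheme" and P :: "('p, 'c) monoid_scheme"
  assumes groups: "group K" "group G" "group A" "group P"
    and fin: "finite (carrier A)" "finite (carrier P)"
    and \<psi>: "\<psi> \<in> hom K G" "\<psi> ` carrier K = carrier G" and \<pi>: "\<pi> \<in> hom G P"
    and H: "H = kernel K G \<psi>" and \<theta>: "\<theta> \<in> hom (K\<lparr>carrier := H\<rparr>) A"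
    and \<Phi>: "\<Phi> \<subseteq> carrier K"
    and sep_\<theta>: "\<forall>x\<in>\<Phi> \<inter> H. \<theta> x = \<one>\<^bsub>A\<^esub> \<longrightarrow> x = \<one>\<^bsub>K\<^esub>"
    and sep_\<pi>: "\<forall>x\<in>\<Phi>. \<pi> (\<psi> x) = \<one>\<^bsub>P\<^esub> \<longrightarrow> x \<in> H"
    and lift: "\<forall>I\<subseteq>carrier P. card I \<le> N \<longrightarrow> (\<exists>\<sigma>. \<sigma> \<in> carrier P \<rightarrow> carrier G \<and>
      \<sigma> \<one>\<^bsub>P\<^esub> = \<one>\<^bsub>G\<^esub> \<and> (\<forall>p\<in>I. \<forall>x\<in>\<psi> ` \<Phi>. \<sigma> (p \<otimes>\<^bsub>P\<^esub> \<pi> x) = \<sigma> p \<otimes>\<^bsub>G\<^esub> x))"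
    and "N > 0"
  shows "\<exists>(Q :: (('p set \<times> 'p \<Rightarrow> 'a) \<times> 'p) monoid) d \<phi>.
    group Q \<and> finite (carrier Q) \<and> bi_invariant_metric Q d \<and> (\<forall>x y. d x y \<le> 1) \<and>
    (\<forall>g\<in>carrier K. \<phi> g \<in> carrier Q) \<and> \<phi> \<one>\<^bsub>K\<^esub> = \<one>\<^bsub>Q\<^esub> \<and>
    (\<forall>g\<in>\<Phi>. \<forall>h\<in>\<Phi>. g \<otimes>\<^bsub>K\<^esub> h \<in> \<Phi> \<longrightarrow> d (\<phi> (g \<otimes>\<^bsub>K\<^esub> h)) (\<phi> g \<otimes>\<^bsub>Q\<^esub> \<phi> h) \<le> 1 / N) \<and>
    (\<forall>g\<in>\<Phi>. g \<noteq> \<one>\<^bsub>K\<^esub> \<longrightarrow> d (\<phi> g) \<one>\<^bsub>Q\<^esub> = 1)"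
proof -
  interpret K: group K by fact
  interpret G: group G by fact
  interpret A: group A by fact
  interpret P: group P by fact
  interpret \<psi>: group_hom K G \<psi> using groups \<psi> by (simp add: group_hom_def group_hom_axioms_def)
  interpret \<pi>: group_hom G P \<pi> using groups \<pi> by (simp add: group_hom_def group_hom_axioms_def)
  have "subgroup H K" unfolding H by (rule \<psi>.subgroup_kernel)
  then interpret H: subgroup H K .
  have \<theta>_mult: "\<theta> (x \<otimes>\<^bsub>K\<^esub> y) = \<theta> x \<otimes>\<^bsub>A\<^esub> \<theta> y" if "x \<in> H" "y \<in> H" for x y
    using \<theta> that by (simp add: hom_def)
  have \<theta>_closed: "\<theta> x \<in> carrier A" if "x \<in> H" for x
    using \<theta> that by (auto simp: hom_def)
  have \<theta>_one: "\<theta> \<one>\<^bsub>K\<^esub> = \<one>\<^bsub>A\<^esub>"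
    using hom_one[OF \<theta> H.subgroup_is_group[OF groups(1)] groups(3)] by simp
  define S where "S = {I. I \<subseteq> carrier P \<and> card I \<le> N}"
  have "finite S" using fin(2) unfolding S_def by (auto intro: finite_subset[of _ "Pow (carrier P)"])
  interpret W: support_wreath A P S by unfold_locales
  have "\<forall>I\<in>S. \<exists>\<sigma>. \<sigma> \<in> carrier P \<rightarrow> carrier G \<and>
    \<sigma> \<one>\<^bsub>P\<^esub> = \<one>\<^bsub>G\<^esub> \<and> (\<forall>p\<in>I. \<forall>x\<in>\<psi> ` \<Phi>. \<sigma> (p \<otimes>\<^bsub>P\<^esub> \<pi> x) = \<sigma> p \<otimes>\<^bsub>G\<^esub> x)"
    using lift unfolding S_def by simp
  from bchoice[OF this] obtain \<sigma> where \<sigma>_all: "\<forall>I\<in>S. \<sigma> I \<in> carrier P \<rightarrow> carrier G \<and>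
    \<sigma> I \<one>\<^bsub>P\<^esub> = \<one>\<^bsub>G\<^esub> \<and> (\<forall>p\<in>I. \<forall>x\<in>\<psi> ` \<Phi>. \<sigma> I (p \<otimes>\<^bsub>P\<^esub> \<pi> x) = \<sigma> I p \<otimes>\<^bsub>G\<^esub> x)"
    by (elim exE)
  have \<sigma>: "\<sigma> I \<in> carrier P \<rightarrow> carrier G" "\<sigma> I \<one>\<^bsub>P\<^esub> = \<one>\<^bsub>G\<^esub>" if "I \<in> S" for I
    using \<sigma>_all that by simp_all
  have eqv: "\<sigma> I (p \<otimes>\<^bsub>P\<^esub> \<pi> (\<psi> x)) = \<sigma> I p \<otimes>\<^bsub>G\<^esub> \<psi> x" if "I \<in> S" "p \<in> I" "x \<in> \<Phi>" for I p x
    using \<sigma>_all that by simp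
  \<comment> \<open>The value at the unit is forced, because \<open>inv_into\<close> could return
    any element of \<open>H\<close> there.\<close>
  define s where "s y = (if y = \<one>\<^bsub>G\<^esub> then \<one>\<^bsub>K\<^esub> else inv_into (carrier K) \<psi> y)" for y
  have s_one: "s \<one>\<^bsub>G\<^esub> = \<one>\<^bsub>K\<^esub>" by (simp add: s_def)
  have s: "s y \<in> carrier K" "\<psi> (s y) = y" if "y \<in> carrier G" for y
    using that \<psi>(2) by (auto simp: s_def inv_into_into f_inv_into_f)
  define \<tau> where "\<tau> I p = s (\<sigma> I p)" for I p
  have \<tau>: "\<tau> I p \<in> carrier K" "\<psi> (\<tau> I p) = \<sigma> I p" if "I \<in> S" "p \<in> carrier P" for I p
    using s[of "\<sigma> I p"] \<sigma>(1)[OF that(1)] that(2) by (auto simp: \<tau>_def Pi_iff)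
  have \<tau>_one: "\<tau> I \<one>\<^bsub>P\<^esub> = \<one>\<^bsub>K\<^esub>" if "I \<in> S" for I
    using \<sigma>(2)[OF that] by (simp add: \<tau>_def s_one)
  define \<kappa> where "\<kappa> I p g = \<tau> I p \<otimes>\<^bsub>K\<^esub> g \<otimes>\<^bsub>K\<^esub> inv\<^bsub>K\<^esub> (\<tau> I (p \<otimes>\<^bsub>P\<^esub> \<pi> (\<psi> g)))" for I p g
  \<comment> \<open>Equivariance of \<open>\<sigma> I\<close> is known only at points of
    \<open>I\<close>; at other positions the cocycle may leave \<open>H\<close>.\<close>
  have \<kappa>_in_H: "\<kappa> I p g \<in> H" if "I \<in> S" "p \<in> I" "g \<in> \<Phi>" for I p g
  proof -
    have p: "p \<in> carrier P" and g: "g \<in> carrier K" using that \<Phi> by (auto simp: S_def)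
    have \<sigma>p: "\<sigma> I p \<in> carrier G" using \<sigma>(1)[OF that(1)] p by auto
    have "\<psi> (\<kappa> I p g) = \<sigma> I p \<otimes>\<^bsub>G\<^esub> \<psi> g \<otimes>\<^bsub>G\<^esub> inv\<^bsub>G\<^esub> (\<sigma> I p \<otimes>\<^bsub>G\<^esub> \<psi> g)"
      using p g \<tau> that eqv[OF that] by (simp add: \<kappa>_def)
    also have "\<dots> = \<one>\<^bsub>G\<^esub>" using \<sigma>p g by simp
    finally have "\<psi> (\<kappa> I p g) = \<one>\<^bsub>G\<^esub>" .
    moreover have "\<kappa> I p g \<in> carrier K" using p g \<tau>(1) that(1) by (simp add: \<kappa>_def)
    ultimately show ?thesis unfolding H kernel_def by blast
  qed
  \<comment> \<open>The cocycle identity holds at all positions, since the lift at the intermediate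
    position cancels.\<close>
  have \<kappa>_mult: "\<kappa> I p g \<otimes>\<^bsub>K\<^esub> \<kappa> I (p \<otimes>\<^bsub>P\<^esub> \<pi> (\<psi> g)) h = \<kappa> I p (g \<otimes>\<^bsub>K\<^esub> h)"
    if "I \<in> S" "p \<in> carrier P" "g \<in> carrier K" "h \<in> carrier K" for I p g h
  proof -
    let ?a = "\<tau> I p" and ?b = "\<tau> I (p \<otimes>\<^bsub>P\<^esub> \<pi> (\<psi> g))" and ?c = "\<tau> I (p \<otimes>\<^bsub>P\<^esub> \<pi> (\<psi> (g \<otimes>\<^bsub>K\<^esub> h)))"
    have q: "p \<otimes>\<^bsub>P\<^esub> \<pi> (\<psi> g) \<in> carrier P" using that(2-4) by simp
    have r: "p \<otimes>\<^bsub>P\<^esub> \<pi> (\<psi> (g \<otimes>\<^bsub>K\<^esub> h)) \<in> carrier P" using that(2-4) by simp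
    have abc: "?a \<in> carrier K" "?b \<in> carrier K" "?c \<in> carrier K"
      by (rule \<tau>(1); fact)+
    from K.mult_inv_telescope[OF abc that(3,4)] show ?thesis
      using that by (simp add: \<kappa>_def P.m_assoc)
  qed
  \<comment> \<open>The default 1 covers cocycle values outside the domain of
    \<open>\<theta>\<close>. For \<open>g \<in> \<Phi>\<close> it is used only at positions outside
    \<open>I\<close>, which membership in \<open>W.small 1\<close> does not test.\<close>
  define lam where "lam I p g = (if \<kappa> I p g \<in> H then \<theta> (\<kappa> I p g) else \<one>\<^bsub>A\<^esub>)" for I p g
  have lam_closed: "lam I p g \<in> carrier A" for I p g
    using \<theta>_closed by (simp add: lam_def)
  define \<phi> where "\<phi> g = (\<lambda>z\<in>S \<times> carrier P. lam (fst z) (snd z) g, \<pi> (\<psi> g))" for g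
  have \<phi>_closed: "\<phi> g \<in> carrier W.Q" if "g \<in> carrier K" for g
    using that lam_closed by (simp add: \<phi>_def)
  have fst_\<phi>: "fst (\<phi> g) (I, p) = lam I p g" if "I \<in> S" "p \<in> carrier P" for g I p
    using that by (simp add: \<phi>_def)
  have snd_\<phi>: "snd (\<phi> g) = \<pi> (\<psi> g)" for g by (simp add: \<phi>_def)
  define d where "d x y = real (LEAST n. N \<le> n \<or> x \<otimes>\<^bsub>W.Q\<^esub> inv\<^bsub>W.Q\<^esub> y \<in> W.small n) / real N" for x y
  note metric = bi_invariant_metric_of_filtration[OF W.group_Q \<open>N > 0\<close> W.small_0 W.small_inv W.small_conj W.small_mult,
      folded d_def]
  show ?thesis
  proof (intro exI[of _ W.Q] exI[of _ d] exI[of _ \<phi>] conjI allI ballI impI)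
    show "bi_invariant_metric W.Q d" by (rule metric(1)) auto
    show "d x y \<le> 1" for x y by (rule metric(2)) auto
    show "finite (carrier W.Q)" using \<open>finite S\<close> fin by (rule W.finite_Q)
    show "\<phi> \<one>\<^bsub>K\<^esub> = \<one>\<^bsub>W.Q\<^esub>"
    proof (rule W.Q_eqI)
      fix I p assume "I \<in> S" "p \<in> carrier P"
      then have "\<kappa> I p \<one>\<^bsub>K\<^esub> = \<one>\<^bsub>K\<^esub>" using \<tau>(1) by (simp add: \<kappa>_def)
      then show "fst (\<phi> \<one>\<^bsub>K\<^esub>) (I, p) = fst \<one>\<^bsub>W.Q\<^esub> (I, p)"
        using \<open>I \<in> S\<close> \<open>p \<in> carrier P\<close> by (simp add: fst_\<phi> lam_def \<theta>_one)
    qed (use \<phi>_closed in \<open>simp_all add: snd_\<phi>\<close>)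
  next
    fix g h assume gh: "g \<in> \<Phi>" "h \<in> \<Phi>" "g \<otimes>\<^bsub>K\<^esub> h \<in> \<Phi>"
    then have K: "g \<in> carrier K" "h \<in> carrier K" using \<Phi> by auto
    have "\<phi> (g \<otimes>\<^bsub>K\<^esub> h) \<otimes>\<^bsub>W.Q\<^esub> inv\<^bsub>W.Q\<^esub> (\<phi> g \<otimes>\<^bsub>W.Q\<^esub> \<phi> h) \<in> W.small 1"
    proof (rule W.mult_inv_in_small_1)
      fix I p assume I: "I \<in> S" "p \<in> I" and p: "p \<in> carrier P"
      let ?q = "p \<otimes>\<^bsub>P\<^esub> \<pi> (\<psi> g)"
      have q: "?q \<in> carrier P" using p K by simp
      have 1: "\<kappa> I p g \<in> H" and 3: "\<kappa> I p (g \<otimes>\<^bsub>K\<^esub> h) \<in> H"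
        using \<kappa>_in_H[OF I] gh by auto
      have \<kappa>q: "\<kappa> I ?q h \<in> carrier K" using q K \<tau>(1) I(1) by (simp add: \<kappa>_def)
      have "\<kappa> I ?q h = inv\<^bsub>K\<^esub> (\<kappa> I p g) \<otimes>\<^bsub>K\<^esub> \<kappa> I p (g \<otimes>\<^bsub>K\<^esub> h)"
        using \<kappa>_mult[OF I(1) p K] 1 3 \<kappa>q K.inv_solve_left[of "\<kappa> I ?q h" "\<kappa> I p g" "\<kappa> I p (g \<otimes>\<^bsub>K\<^esub> h)"]
        by simp
      then have 2: "\<kappa> I ?q h \<in> H" using 1 3 by simp
      have "lam I p (g \<otimes>\<^bsub>K\<^esub> h) = lam I p g \<otimes>\<^bsub>A\<^esub> lam I ?q h"
        using 1 2 3 by (simp add: lam_def flip: \<theta>_mult \<kappa>_mult[OF I(1) p K])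
      then show "fst (\<phi> (g \<otimes>\<^bsub>K\<^esub> h)) (I, p) = fst (\<phi> g \<otimes>\<^bsub>W.Q\<^esub> \<phi> h) (I, p)"
        using I p q by (simp add: fst_\<phi> snd_\<phi>)
    qed (use \<phi>_closed K in \<open>simp_all add: snd_\<phi>\<close>)
    then have "d (\<phi> (g \<otimes>\<^bsub>K\<^esub> h)) (\<phi> g \<otimes>\<^bsub>W.Q\<^esub> \<phi> h) \<le> real 1 / real N"
      by (intro metric(3)) auto
    then show "d (\<phi> (g \<otimes>\<^bsub>K\<^esub> h)) (\<phi> g \<otimes>\<^bsub>W.Q\<^esub> \<phi> h) \<le> 1 / N" by simp
  next
    fix g assume g: "g \<in> \<Phi>" "g \<noteq> \<one>\<^bsub>K\<^esub>"
    then have gK: "g \<in> carrier K" using \<Phi> by auto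
    \<comment> \<open>If the component in \<open>P\<close> is nontrivial, \<open>\<phi> g\<close> is
      in no \<open>W.small n\<close>. Otherwise \<open>g \<in> H\<close>, and both lifts in the
      cocycle at position 1 are trivial, which leaves the value \<open>\<theta> g\<close>.\<close>
    have "\<phi> g \<notin> W.small n" if "n < N" for n
    proof (rule W.notin_small)
      assume "snd (\<phi> g) = \<one>\<^bsub>P\<^esub>"
      then have \<pi>g: "\<pi> (\<psi> g) = \<one>\<^bsub>P\<^esub>" by (simp add: snd_\<phi>)
      then have "g \<in> H" using sep_\<pi> g by blast
      show "\<forall>J\<in>S. fst (\<phi> g) (J, \<one>\<^bsub>P\<^esub>) \<noteq> \<one>\<^bsub>A\<^esub>"
      proof
        fix J assume "J \<in> S"
        then have "\<kappa> J \<one>\<^bsub>P\<^esub> g = g" using gK \<tau>_one \<pi>g by (simp add: \<kappa>_def)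
        then show "fst (\<phi> g) (J, \<one>\<^bsub>P\<^esub>) \<noteq> \<one>\<^bsub>A\<^esub>"
          using \<open>J \<in> S\<close> \<open>g \<in> H\<close> sep_\<theta> g by (auto simp: fst_\<phi> lam_def)
      qed
    qed (use that in \<open>simp add: S_def\<close>)
    then have "\<And>n. n < N \<Longrightarrow> \<phi> g \<otimes>\<^bsub>W.Q\<^esub> inv\<^bsub>W.Q\<^esub> \<one>\<^bsub>W.Q\<^esub> \<notin> W.small n"
      using \<phi>_closed[OF gK] by simp
    then show "d (\<phi> g) \<one>\<^bsub>W.Q\<^esub> = 1"
      by (intro metric(4)) auto
  qed (use \<phi>_closed in \<open>auto\<close>)
qed

section \<open>Choice of the finite quotients\<close>

theorem theorem1:
  fixes K :: "('a, 'b) monoid_scheme" and H :: "'a set"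
  assumes "group K"
    and "H \<lhd> K"
    and "residually_finite (K \<lparr>carrier := H\<rparr>)"
    and "residually_finite (K Mod H)"
  shows "weakly_sofic K"
  unfolding weakly_sofic_def
\<comment> \<open>Nontrivial elements of \<open>\<Phi>\<close> will have distance exactly 1 from the
  unit, so 1/2 serves for all \<open>\<Phi>\<close> and \<open>\<epsilon>\<close>.\<close>
proof (intro exI[of _ "1/2 :: real"] conjI allI impI; (elim conjE)?)
  fix \<Phi> and \<epsilon> :: real
  assume \<Phi>: "\<Phi> \<subseteq> carrier K" "finite \<Phi>" and "\<epsilon> > 0"
  interpret K: group K by fact
  interpret H: normal H K by fact
  interpret G: group "K Mod H" by (rule H.factorgroup_is_group)
  interpret KH: group "K\<lparr>carrier := H\<rparr>" by (rule H.subgroup_is_group[OF assms(1)])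
  obtain N :: nat where N: "N > 0" "1 / N < \<epsilon>"
    using ex_inverse_of_nat_less[OF \<open>\<epsilon> > 0\<close>] by (auto simp: inverse_eq_divide)
  define \<psi> where "\<psi> = (\<lambda>x. H #>\<^bsub>K\<^esub> x)"
  have \<psi>: "\<psi> \<in> hom K (K Mod H)" "\<psi> ` carrier K = carrier (K Mod H)"
    and \<psi>_one: "\<And>x. x \<in> carrier K \<Longrightarrow> \<psi> x = \<one>\<^bsub>K Mod H\<^esub> \<longleftrightarrow> x \<in> H"
    unfolding \<psi>_def using K.FactGroup_projection[OF assms(2)] by auto
  have ker: "H = kernel K (K Mod H) \<psi>"
    using \<psi>_one H.subset by (auto simp: kernel_def)
  let ?E = "insert \<one>\<^bsub>K Mod H\<^esub> (\<psi> ` \<Phi>)"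
  have E: "finite ?E" "?E \<subseteq> carrier (K Mod H)" using \<Phi> \<psi>(2) G.one_closed by auto
  from G.equivariant_lift[OF E insertI1, where k = N]
  obtain D where D: "finite D" "D \<subseteq> carrier (K Mod H)"
    and lift: "\<forall>(P :: 'a set set monoid) \<pi> I.
       group P \<and> \<pi> \<in> hom (K Mod H) P \<and> (\<forall>x\<in>D. \<pi> x = \<one>\<^bsub>P\<^esub> \<longrightarrow> x = \<one>\<^bsub>K Mod H\<^esub>) \<and>
       I \<subseteq> carrier P \<and> finite I \<and> card I \<le> N \<longrightarrow>
       (\<exists>\<sigma>. \<sigma> \<in> carrier P \<rightarrow> carrier (K Mod H) \<and>
         (\<forall>p\<in>I. \<forall>x\<in>?E. \<sigma> (p \<otimes>\<^bsub>P\<^esub> \<pi> x) = \<sigma> p \<otimes>\<^bsub>K Mod H\<^esub> x))"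
    by (elim exE conjE)
  obtain M where M: "M \<lhd> K Mod H" "finite (rcosets\<^bsub>K Mod H\<^esub> M)"
    and M_sep: "\<forall>x\<in>D \<union> \<psi> ` \<Phi>. x \<in> M \<longrightarrow> x = \<one>\<^bsub>K Mod H\<^esub>"
    using G.residually_finite_separates_finite_set[OF assms(4), of "D \<union> \<psi> ` \<Phi>"] D E by auto
  \<comment> \<open>Normality of \<open>L\<close> in \<open>H\<close> suffices, because
    \<open>\<theta>\<close> is applied only to cocycle values lying in \<open>H\<close>.\<close>
  obtain L where L: "L \<lhd> K\<lparr>carrier := H\<rparr>" "finite (rcosets\<^bsub>K\<lparr>carrier := H\<rparr>\<^esub> L)"
    and L_sep: "\<forall>x\<in>\<Phi> \<inter> H. x \<in> L \<longrightarrow> x = \<one>\<^bsub>K\<^esub>"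
    using KH.residually_finite_separates_finite_set[OF assms(3), of "\<Phi> \<inter> H"] \<Phi> by auto
  let ?A = "K\<lparr>carrier := H\<rparr> Mod L" and ?P = "(K Mod H) Mod M"
  define \<theta> where "\<theta> = (\<lambda>x. L #>\<^bsub>K\<lparr>carrier := H\<rparr>\<^esub> x)"
  define \<pi> where "\<pi> = (\<lambda>x. M #>\<^bsub>K Mod H\<^esub> x)"
  have \<theta>: "\<theta> \<in> hom (K\<lparr>carrier := H\<rparr>) ?A" and \<theta>_one: "\<And>x. x \<in> H \<Longrightarrow> \<theta> x = \<one>\<^bsub>?A\<^esub> \<longleftrightarrow> x \<in> L"
    unfolding \<theta>_def using KH.FactGroup_projection[OF L(1)] by auto
  have \<pi>: "\<pi> \<in> hom (K Mod H) ?P" and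
    \<pi>_one: "\<And>x. x \<in> carrier (K Mod H) \<Longrightarrow> \<pi> x = \<one>\<^bsub>?P\<^esub> \<longleftrightarrow> x \<in> M"
    unfolding \<pi>_def using G.FactGroup_projection[OF M(1)] by auto
  have groups: "group ?A" "group ?P"
    using L(1) M(1) by (auto intro: normal.factorgroup_is_group)
  have fin: "finite (carrier ?A)" "finite (carrier ?P)"
    using L(2) M(2) by (simp_all add: FactGroup_def)
  have normalized: "\<forall>I\<subseteq>carrier ?P. card I \<le> N \<longrightarrow>
      (\<exists>\<sigma>. \<sigma> \<in> carrier ?P \<rightarrow> carrier (K Mod H) \<and> \<sigma> \<one>\<^bsub>?P\<^esub> = \<one>\<^bsub>K Mod H\<^esub> \<and>
      (\<forall>p\<in>I. \<forall>x\<in>\<psi> ` \<Phi>. \<sigma> (p \<otimes>\<^bsub>?P\<^esub> \<pi> x) = \<sigma> p \<otimes>\<^bsub>K Mod H\<^esub> x))"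
  proof (intro allI impI)
    fix I assume I: "I \<subseteq> carrier ?P" "card I \<le> N"
    have "\<exists>\<sigma>. \<sigma> \<in> carrier ?P \<rightarrow> carrier (K Mod H) \<and>
         (\<forall>p\<in>I. \<forall>x\<in>?E. \<sigma> (p \<otimes>\<^bsub>?P\<^esub> \<pi> x) = \<sigma> p \<otimes>\<^bsub>K Mod H\<^esub> x)"
      using I groups(2) \<pi> M_sep \<pi>_one D(2) fin(2)
      by (intro lift[rule_format] conjI ballI impI) (auto intro: finite_subset)
    then obtain \<sigma> where "\<sigma> \<in> carrier ?P \<rightarrow> carrier (K Mod H)"
      "\<forall>p\<in>I. \<forall>x\<in>\<psi> ` \<Phi>. \<sigma> (p \<otimes>\<^bsub>?P\<^esub> \<pi> x) = \<sigma> p \<otimes>\<^bsub>K Mod H\<^esub> x" by blast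
    moreover have "\<pi> \<in> \<psi> ` \<Phi> \<rightarrow> carrier ?P" using \<pi> E by (auto simp: hom_def)
    ultimately show "\<exists>\<sigma>. \<sigma> \<in> carrier ?P \<rightarrow> carrier (K Mod H) \<and> \<sigma> \<one>\<^bsub>?P\<^esub> = \<one>\<^bsub>K Mod H\<^esub> \<and>
      (\<forall>p\<in>I. \<forall>x\<in>\<psi> ` \<Phi>. \<sigma> (p \<otimes>\<^bsub>?P\<^esub> \<pi> x) = \<sigma> p \<otimes>\<^bsub>K Mod H\<^esub> x)"
      using E I by (intro G.normalized_equivariant_lift[OF groups(2)]) auto
  qed
  have sep_\<pi>: "\<forall>x\<in>\<Phi>. \<pi> (\<psi> x) = \<one>\<^bsub>?P\<^esub> \<longrightarrow> x \<in> H"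
  proof (intro ballI impI)
    fix x assume x: "x \<in> \<Phi>" "\<pi> (\<psi> x) = \<one>\<^bsub>?P\<^esub>"
    then have "\<psi> x \<in> M" using \<pi>_one E(2) by blast
    with x(1) M_sep have "\<psi> x = \<one>\<^bsub>K Mod H\<^esub>" by blast
    with x(1) \<psi>_one \<Phi>(1) show "x \<in> H" by blast
  qed
  have sep_\<theta>: "\<forall>x\<in>\<Phi> \<inter> H. \<theta> x = \<one>\<^bsub>?A\<^esub> \<longrightarrow> x = \<one>\<^bsub>K\<^esub>"
    using \<theta>_one L_sep by blast
  from finite_approximation[OF assms(1) G.is_group groups fin \<psi> \<pi> ker \<theta> \<Phi>(1) sep_\<theta> sep_\<pi> normalized N(1)]
  obtain Q :: "(('a set set set \<times> 'a set set \<Rightarrow> 'a set) \<times> 'a set set) monoid" and d \<phi>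
    where Q: "group Q" "finite (carrier Q)" "bi_invariant_metric Q d" "\<forall>x y. d x y \<le> 1"
    and \<phi>: "\<forall>g\<in>carrier K. \<phi> g \<in> carrier Q" "\<phi> \<one>\<^bsub>K\<^esub> = \<one>\<^bsub>Q\<^esub>"
    "\<forall>g\<in>\<Phi>. \<forall>h\<in>\<Phi>. g \<otimes>\<^bsub>K\<^esub> h \<in> \<Phi> \<longrightarrow> d (\<phi> (g \<otimes>\<^bsub>K\<^esub> h)) (\<phi> g \<otimes>\<^bsub>Q\<^esub> \<phi> h) \<le> 1 / N"
    "\<forall>g\<in>\<Phi>. g \<noteq> \<one>\<^bsub>K\<^esub> \<longrightarrow> d (\<phi> g) \<one>\<^bsub>Q\<^esub> = 1"
    by (elim exE conjE)
  interpret Q: group Q by fact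
  obtain Q' :: "nat monoid" and f where Q': "group Q'" and f: "f \<in> iso Q Q'" and "finite (carrier Q')"
    using nat_copy_of_finite_group[OF Q(1,2)] .
  interpret f: group_hom Q Q' f
    using Q(1) Q' f by (simp add: group_hom_def group_hom_axioms_def iso_def)
  define d' where "d' x y = d (inv_into (carrier Q) f x) (inv_into (carrier Q) f y)" for x y
  have d': "d' (f x) (f y) = d x y" if "x \<in> carrier Q" "y \<in> carrier Q" for x y
    using f that by (simp add: d'_def iso_def bij_betw_def)
  have "bi_invariant_metric Q' d'"
    unfolding d'_def by (rule bi_invariant_metric_iso[OF Q(1) Q' f Q(3)])
  moreover have "d' (f (\<phi> (g \<otimes>\<^bsub>K\<^esub> h))) (f (\<phi> g) \<otimes>\<^bsub>Q'\<^esub> f (\<phi> h)) < \<epsilon>"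
    if "g \<in> \<Phi>" "h \<in> \<Phi>" "g \<otimes>\<^bsub>K\<^esub> h \<in> \<Phi>" for g h
  proof -
    have "\<phi> g \<in> carrier Q" "\<phi> h \<in> carrier Q" "\<phi> (g \<otimes>\<^bsub>K\<^esub> h) \<in> carrier Q"
      using that \<Phi> \<phi>(1) by auto
    then have "d' (f (\<phi> (g \<otimes>\<^bsub>K\<^esub> h))) (f (\<phi> g) \<otimes>\<^bsub>Q'\<^esub> f (\<phi> h)) = d (\<phi> (g \<otimes>\<^bsub>K\<^esub> h)) (\<phi> g \<otimes>\<^bsub>Q\<^esub> \<phi> h)"
      using d'[of "\<phi> (g \<otimes>\<^bsub>K\<^esub> h)" "\<phi> g \<otimes>\<^bsub>Q\<^esub> \<phi> h"] by simp
    with \<phi>(3)[rule_format, OF that] N(2) show ?thesis by simp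
  qed
  moreover have "d' (f (\<phi> g)) \<one>\<^bsub>Q'\<^esub> > 1/2" if "g \<in> \<Phi> - {\<one>\<^bsub>K\<^esub>}" for g
    using d'[of "\<phi> g" "\<one>\<^bsub>Q\<^esub>"] \<phi>(1,4) that \<Phi>(1) by auto
  \<comment> \<open>The bound on \<open>d\<close> holds for all arguments, so the values of
    \<open>inv_into\<close> off the image of \<open>f\<close> do no harm.\<close>
  moreover have "d' x y \<le> 1" for x y
    unfolding d'_def using Q(4) by blast
  ultimately show "\<exists>(Q :: nat monoid) (d :: nat \<Rightarrow> nat \<Rightarrow> real) (\<phi> :: 'a \<Rightarrow> nat).
      group Q \<and> finite (carrier Q) \<and> bi_invariant_metric Q d \<and>
      (\<forall>x \<in> carrier Q. \<forall>y \<in> carrier Q. d x y \<le> 1) \<and>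
      (\<forall>g \<in> \<Phi>. \<phi> g \<in> carrier Q) \<and>
      (\<one>\<^bsub>K\<^esub> \<in> \<Phi> \<longrightarrow> \<phi> \<one>\<^bsub>K\<^esub> = \<one>\<^bsub>Q\<^esub>) \<and>
      (\<forall>g \<in> \<Phi>. \<forall>h \<in> \<Phi>. g \<otimes>\<^bsub>K\<^esub> h \<in> \<Phi> \<longrightarrow> d (\<phi> (g \<otimes>\<^bsub>K\<^esub> h)) (\<phi> g \<otimes>\<^bsub>Q\<^esub> \<phi> h) < \<epsilon>) \<and>
      (\<forall>g \<in> \<Phi> - {\<one>\<^bsub>K\<^esub>}. d (\<phi> g) \<one>\<^bsub>Q\<^esub> > 1/2)"
    using Q' \<open>finite (carrier Q')\<close> \<phi>(1,2) \<Phi>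
    by (intro exI[of _ Q'] exI[of _ d'] exI[of _ "\<lambda>g. f (\<phi> g)"]) auto
qed simp

end
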